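(* Suppose that for every policy in $\Pi_1$ the induced state covariance satisfies $\Sigma_k\in\mathbb{S}_n^{++}$ for all $k\in\{0,\dots,N\}$. Let $\{\mu'_k,v'_k,\Sigma'_k,K'_k,Q'_k\}$ be the (unique) minimizer of the problem (NLP) and let $\{\mu''_k,v''_k,\Sigma''_k,P''_k,M''_k,L\}$ be the (unique) minimizer of the problem (SDP), both problems being defined in the context. Then for all $k\in\{0,\dots,N-1\}$, $$v'_k=v''_k,\quad \mu'_k=\mu''_k,\quad \Sigma'_k=\Sigma''_k,\quad K'_k=P''_k(\Sigma''_k)^{-1},\quad Q'_k=M''_k-P''_k(\Sigma''_k)^{-1}(P''_k)^{\mathrm T}.$$
   Context: $\mathbb{S}_n^{+}$ and $\mathbb{S}_n^{++}$ denote the real symmetric positive semidefinite and positive definite $n\times n$ matrices; $X\succeq0$ means $X$ is symmetric positive semidefinite; $I_n$ is the identity. Data: $N\in\mathbb{Z}^+$, $\lambda>0$, $\mu_0,\mu_{\mathrm d}\in\mathbb{R}^n$, $\Sigma_0,\Sigma_{\mathrm d}\in\mathbb{S}_n^{++}$, and for $k=0,\dots,N-1$: $A_k\in\mathbb{R}^{n\times n}$, $B_k\in\mathbb{R}^{n\times m}$, $W_k\in\mathbb{S}_n^{+}$, $R_k\in\mathbb{S}_m^{++}$. In both problems $\mu_0$ and $\Sigma_0$ are fixed to the given data. Policies $\Pi_1$ (used only in the hypothesis): for the system $x_{k+1}=A_kx_k+B_ku_k+w_k$, with $x_0\sim\mathcal N(\mu_0,\Sigma_0)$ and $w_k\sim\mathcal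 N(0,W_k)$ all independent, $\Pi_1$ is the set of policies $u_k=v_k+\sum_{\tau=0}^{k}K_{k,\tau}(x_\tau-\mathbb{E}[x_\tau])$ with arbitrary $v_k\in\mathbb{R}^m$, $K_{k,\tau}\in\mathbb{R}^{m\times n}$; in the hypothesis $\Sigma_k$ denotes the covariance of $x_k$ under such a policy. Problem (NLP): minimize over $v_k\in\mathbb{R}^m$, $K_k\in\mathbb{R}^{m\times n}$, $Q_k\in\mathbb{S}_m^{+}$ ($0\le k\le N-1$) and $\mu_k\in\mathbb{R}^n$, $\Sigma_k\in\mathbb{S}_n^{+}$ ($0\le k\le N$, with $\mu_0,\Sigma_0$ given) the objective $$\sum_{k=0}^{N-1}\Big(v_k^{\mathrm T}R_kv_k+\operatorname{tr}\big(R_k(K_k\Sigma_kK_k^{\mathrm T}+Q_k)\big)\Big)+\lambda\Big(\|\mu_N-\mu_{\mathrm d}\|_2^2+\operatorname{tr}(\Sigma_N+\Sigma_{\mathrm d})-2\operatorname{tr}\big((\sqrt{\Sigma_{\mathrm d}}\,\Sigma_N\sqrt{\Sigma_{\mathrm d}})^{1/2}\big)\Big)$$ subject to, for $k=0,\dots,N-1$, $$\mu_{k+1}=A_k\mu_k+B_kv_k,\qquad \Sigma_{k+1}=(A_k+B_kK_k)\Sigma_k(A_k+B_kK_k)^{\mathrm T}+B_kQ_kB_k^{\mathrm T}+W_k.$$ Problem (SDP): minimize over $v_k\in\mathbb{R}^m$, $P_k\in\mathbb{R}^{m\times n}$, $M_k\in\mathbb{S}_m^{+}$ ($0\le k\le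 N-1$), $\mu_k\in\mathbb{R}^n$, $\Sigma_k\in\mathbb{S}_n^{+}$ ($0\le k\le N$, with $\mu_0,\Sigma_0$ given) and $L\in\mathbb{S}_n^{+}$ the objective $$\sum_{k=0}^{N-1}\big(v_k^{\mathrm T}R_kv_k+\operatorname{tr}(R_kM_k)\big)+\lambda\big(\|\mu_N-\mu_{\mathrm d}\|_2^2+\operatorname{tr}(\Sigma_N+\Sigma_{\mathrm d}-2L)\big)$$ subject to, for $k=0,\dots,N-1$, $$\mu_{k+1}=A_k\mu_k+B_kv_k,\qquad \Sigma_{k+1}=A_k\Sigma_kA_k^{\mathrm T}+A_kP_k^{\mathrm T}B_k^{\mathrm T}+B_kP_kA_k^{\mathrm T}+B_kM_kB_k^{\mathrm T}+W_k,$$ $$\begin{bmatrix}M_k&P_k\\P_k^{\mathrm T}&\Sigma_k\end{bmatrix}\succeq0,\qquad\text{and}\qquad \begin{bmatrix}\Sigma_N&\Sigma_{\mathrm d}^{-1/2}L\\L\Sigma_{\mathrm d}^{-1/2}&I_n\end{bmatrix}\succeq0.$$ *)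

theory Defs
  imports "HOL-Probability.Probability"
begin

section \<open>Matrices\<close>

definition psd :: "real^'n^'n \<Rightarrow> bool" where
  "psd X \<longleftrightarrow> transpose X = X \<and> (\<forall>x. 0 \<le> x \<bullet> (X *v x))"

definition pd :: "real^'n^'n \<Rightarrow> bool" where
  "pd X \<longleftrightarrow> transpose X = X \<and> (\<forall>x. x \<noteq> 0 \<longrightarrow> 0 < x \<bullet> (X *v x))"

text \<open>The principal square root; only meaningful for positive semidefinite arguments.\<close>

definition mat_sqrt :: "real^'n^'n \<Rightarrow> real^'n^'n" where
  "mat_sqrt X = (THE Y. psd Y \<and> Y ** Y = X)"

definition block_mat ::
  "real^'c^'r \<Rightarrow> real^'d^'r \<Rightarrow> real^'c^'s \<Rightarrow> real^'d^'s \<Rightarrow> real^('c + 'd)^('r + 's)" where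
  "block_mat X Y Z U = (\<chi> i j.
     case i of
       Inl r \<Rightarrow> (case j of Inl c \<Rightarrow> X $ r $ c | Inr d \<Rightarrow> Y $ r $ d)
     | Inr s \<Rightarrow> (case j of Inl c \<Rightarrow> Z $ s $ c | Inr d \<Rightarrow> U $ s $ d))"


section \<open>Gaussian vectors and the controlled system\<close>

text \<open>
  Since S may be singular, a Gaussian vector is defined by requiring every one-dimensional marginal
  to be Gaussian, a vanishing variance meaning a point mass. The second argument of
  \<^const>\<open>normal_density\<close> is the standard deviation.
\<close>

definition gaussian_rv :: "'w measure \<Rightarrow> ('w \<Rightarrow> real^'n) \<Rightarrow> real^'n \<Rightarrow> real^'n^'n \<Rightarrow> bool" where
  "gaussian_rv M X m S \<longleftrightarrow>
     X \<in> borel_measurable M \<and>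
     (\<forall>a. distr M borel (\<lambda>\<omega>. a \<bullet> X \<omega>) =
        (if a \<bullet> (S *v a) = 0 then return borel (a \<bullet> m)
         else density lborel (normal_density (a \<bullet> m) (sqrt (a \<bullet> (S *v a))))))"

definition covariance_mat :: "'w measure \<Rightarrow> ('w \<Rightarrow> real^'n) \<Rightarrow> real^'n^'n" where
  "covariance_mat M X = (\<chi> i j.
     integral\<^sup>L M (\<lambda>\<omega>. (X \<omega> - integral\<^sup>L M X) $ i * (X \<omega> - integral\<^sup>L M X) $ j))"

text \<open>The family \<^term>\<open>case_nat x0 w\<close> on \<^term>\<open>{..N}\<close> lists x0, w 0, ..., w (N - 1).\<close>

definition system_noise ::
  "'w measure \<Rightarrow> nat \<Rightarrow> real^'n \<Rightarrow> real^'n^'n \<Rightarrow> (nat \<Rightarrow> real^'n^'n) \<Rightarrow>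
   ('w \<Rightarrow> real^'n) \<Rightarrow> (nat \<Rightarrow> 'w \<Rightarrow> real^'n) \<Rightarrow> bool" where
  "system_noise M N \<mu>0 \<Sigma>0 W x0 w \<longleftrightarrow>
     prob_space M \<and>
     gaussian_rv M x0 \<mu>0 \<Sigma>0 \<and>
     (\<forall>k<N. gaussian_rv M (w k) 0 (W k)) \<and>
     prob_space.indep_vars M (\<lambda>_. borel) (case_nat x0 w) {..N}"

text \<open>
  The state process under the policy with feedforward terms v and feedback gains K acting on the
  whole centred state history.
\<close>

context
  notes sum.cong[fundef_cong]
begin

fun state ::
  "'w measure \<Rightarrow> (nat \<Rightarrow> real^'n^'n) \<Rightarrow> (nat \<Rightarrow> real^'m^'n) \<Rightarrow> ('w \<Rightarrow> real^'n) \<Rightarrow>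
   (nat \<Rightarrow> 'w \<Rightarrow> real^'n) \<Rightarrow> (nat \<Rightarrow> real^'m) \<Rightarrow> (nat \<Rightarrow> nat \<Rightarrow> real^'n^'m) \<Rightarrow>
   nat \<Rightarrow> 'w \<Rightarrow> real^'n" where
  "state M A B x0 w v K 0 = x0"
| "state M A B x0 w v K (Suc k) = (\<lambda>\<omega>.
     A k *v state M A B x0 w v K k \<omega> +
     B k *v (v k + (\<Sum>\<tau>\<in>{..k}. K k \<tau> *v
       (state M A B x0 w v K \<tau> \<omega> - integral\<^sup>L M (state M A B x0 w v K \<tau>)))) +
     w k \<omega>)"

end


section \<open>The two optimization problems\<close>

definition unique_arg_min :: "('a \<Rightarrow> real) \<Rightarrow> ('a \<Rightarrow> bool) \<Rightarrow> 'a \<Rightarrow> bool" where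
  "unique_arg_min f P x \<longleftrightarrow> is_arg_min f P x \<and> (\<forall>y. is_arg_min f P y \<longrightarrow> y = x)"

text \<open>
  Finite sequences of decision variables are functions on nat which are \<^const>\<open>extensional\<close> on their
  index range, so that equality of points is equality of the finite sequences.
\<close>

record ('n, 'm) nlp_point =
  nlp_v :: "nat \<Rightarrow> real^'m"
  nlp_K :: "nat \<Rightarrow> real^'n^'m"
  nlp_Q :: "nat \<Rightarrow> real^'m^'m"
  nlp_\<mu> :: "nat \<Rightarrow> real^'n"
  nlp_\<Sigma> :: "nat \<Rightarrow> real^'n^'n"

record ('n, 'm) sdp_point =
  sdp_v :: "nat \<Rightarrow> real^'m"
  sdp_P :: "nat \<Rightarrow> real^'n^'m"
  sdp_M :: "nat \<Rightarrow> real^'m^'m"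
  sdp_\<mu> :: "nat \<Rightarrow> real^'n"
  sdp_\<Sigma> :: "nat \<Rightarrow> real^'n^'n"
  sdp_L :: "real^'n^'n"

definition nlp_feasible ::
  "nat \<Rightarrow> (nat \<Rightarrow> real^'n^'n) \<Rightarrow> (nat \<Rightarrow> real^'m^'n) \<Rightarrow> (nat \<Rightarrow> real^'n^'n) \<Rightarrow>
   real^'n \<Rightarrow> real^'n^'n \<Rightarrow> ('n, 'm) nlp_point \<Rightarrow> bool" where
  "nlp_feasible N A B W \<mu>0 \<Sigma>0 z \<longleftrightarrow>
     nlp_v z \<in> extensional {..<N} \<and> nlp_K z \<in> extensional {..<N} \<and>
     nlp_Q z \<in> extensional {..<N} \<and> nlp_\<mu> z \<in> extensional {..N} \<and>
     nlp_\<Sigma> z \<in> extensional {..N} \<and>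
     nlp_\<mu> z 0 = \<mu>0 \<and> nlp_\<Sigma> z 0 = \<Sigma>0 \<and>
     (\<forall>k\<le>N. psd (nlp_\<Sigma> z k)) \<and>
     (\<forall>k<N.
        psd (nlp_Q z k) \<and>
        nlp_\<mu> z (Suc k) = A k *v nlp_\<mu> z k + B k *v nlp_v z k \<and>
        nlp_\<Sigma> z (Suc k) =
          (A k + B k ** nlp_K z k) ** nlp_\<Sigma> z k ** transpose (A k + B k ** nlp_K z k) +
          B k ** nlp_Q z k ** transpose (B k) + W k)"

definition nlp_cost ::
  "nat \<Rightarrow> (nat \<Rightarrow> real^'m^'m) \<Rightarrow> real \<Rightarrow> real^'n \<Rightarrow> real^'n^'n \<Rightarrow> ('n, 'm) nlp_point \<Rightarrow> real" where
  "nlp_cost N R lam \<mu>d \<Sigma>d z =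
     (\<Sum>k<N. nlp_v z k \<bullet> (R k *v nlp_v z k) +
        trace (R k ** (nlp_K z k ** nlp_\<Sigma> z k ** transpose (nlp_K z k) + nlp_Q z k))) +
     lam * ((norm (nlp_\<mu> z N - \<mu>d))\<^sup>2 + trace (nlp_\<Sigma> z N + \<Sigma>d)
       - 2 * trace (mat_sqrt (mat_sqrt \<Sigma>d ** nlp_\<Sigma> z N ** mat_sqrt \<Sigma>d)))"

definition sdp_feasible ::
  "nat \<Rightarrow> (nat \<Rightarrow> real^'n^'n) \<Rightarrow> (nat \<Rightarrow> real^'m^'n) \<Rightarrow> (nat \<Rightarrow> real^'n^'n) \<Rightarrow>
   real^'n \<Rightarrow> real^'n^'n \<Rightarrow> real^'n^'n \<Rightarrow> ('n, 'm) sdp_point \<Rightarrow> bool" where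
  "sdp_feasible N A B W \<mu>0 \<Sigma>0 \<Sigma>d z \<longleftrightarrow>
     sdp_v z \<in> extensional {..<N} \<and> sdp_P z \<in> extensional {..<N} \<and>
     sdp_M z \<in> extensional {..<N} \<and> sdp_\<mu> z \<in> extensional {..N} \<and>
     sdp_\<Sigma> z \<in> extensional {..N} \<and>
     sdp_\<mu> z 0 = \<mu>0 \<and> sdp_\<Sigma> z 0 = \<Sigma>0 \<and>
     (\<forall>k\<le>N. psd (sdp_\<Sigma> z k)) \<and>
     (\<forall>k<N.
        psd (sdp_M z k) \<and>
        sdp_\<mu> z (Suc k) = A k *v sdp_\<mu> z k + B k *v sdp_v z k \<and>
        sdp_\<Sigma> z (Suc k) =
          A k ** sdp_\<Sigma> z k ** transpose (A k) +
          A k ** transpose (sdp_P z k) ** transpose (B k) +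
          B k ** sdp_P z k ** transpose (A k) +
          B k ** sdp_M z k ** transpose (B k) + W k \<and>
        psd (block_mat (sdp_M z k) (sdp_P z k) (transpose (sdp_P z k)) (sdp_\<Sigma> z k))) \<and>
     psd (sdp_L z) \<and>
     psd (block_mat (sdp_\<Sigma> z N) (matrix_inv (mat_sqrt \<Sigma>d) ** sdp_L z)
            (sdp_L z ** matrix_inv (mat_sqrt \<Sigma>d)) (mat 1))"

definition sdp_cost ::
  "nat \<Rightarrow> (nat \<Rightarrow> real^'m^'m) \<Rightarrow> real \<Rightarrow> real^'n \<Rightarrow> real^'n^'n \<Rightarrow> ('n, 'm) sdp_point \<Rightarrow> real" where
  "sdp_cost N R lam \<mu>d \<Sigma>d z =
     (\<Sum>k<N. sdp_v z k \<bullet> (R k *v sdp_v z k) + trace (R k ** sdp_M z k)) +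
     lam * ((norm (sdp_\<mu> z N - \<mu>d))\<^sup>2 + trace (sdp_\<Sigma> z N + \<Sigma>d - 2 *\<^sub>R sdp_L z))"

end

theory Submission
  imports Defs
begin

text \<open>
  The two problems are the same problem in different coordinates. A feasible point of the
  semidefinite problem whose covariances \<open>\<Sigma>\<^sub>k\<close> are positive definite for \<open>k < N\<close> gives a feasible
  point of the nonlinear problem through \<open>K\<^sub>k = P\<^sub>k \<Sigma>\<^sub>k\<^sup>-\<^sup>1\<close> and the Schur complement
  \<open>Q\<^sub>k = M\<^sub>k - P\<^sub>k \<Sigma>\<^sub>k\<^sup>-\<^sup>1 P\<^sub>k\<^sup>T\<close>: the covariance recursions agree, and \<open>tr (R\<^sub>k M\<^sub>k)\<close> becomes the control
  cost (\<open>sdp_covariance_recursion\<close>). The costs then differ only in the terminal term, where the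
  block constraint on \<open>L\<close> says \<open>L\<^sup>2 \<le> \<Sigma>\<^sub>d\<^sup>1\<^sup>/\<^sup>2 \<Sigma>\<^sub>N \<Sigma>\<^sub>d\<^sup>1\<^sup>/\<^sup>2\<close>. Since the square root is monotone, \<open>tr L\<close> is at most
  the trace of the root of the right-hand side (\<open>bures_trace_le\<close>), so passing to the nonlinear
  problem does not raise the cost. Conversely, \<open>P\<^sub>k = K\<^sub>k \<Sigma>\<^sub>k\<close>, \<open>M\<^sub>k = K\<^sub>k \<Sigma>\<^sub>k K\<^sub>k\<^sup>T + Q\<^sub>k\<close> and the maximal
  \<open>L\<close> turn any feasible point of the nonlinear problem into one of the semidefinite problem with
  the same cost (\<open>sdp_of_nlp_feasible\<close>, \<open>sdp_of_nlp_cost\<close>). Hence the image of the semidefinite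
  minimizer is a minimizer of the nonlinear problem, and uniqueness identifies it with \<open>z'\<close>.

  The hypothesis on the policies provides the positive definiteness that the first map needs
  (\<open>covariance_step_pd\<close>). If one step of the recursion from a positive definite covariance produced
  a null vector \<open>y\<close>, then \<open>y\<close> would be annihilated by \<open>(A\<^sub>k + B\<^sub>k G)\<^sup>T\<close> and \<open>W\<^sub>k\<close>. Under the policy that
  applies the gain \<open>G\<close> to the current state, \<open>y \<bullet> x\<^bsub>k+1\<^esub>\<close> would then be almost surely constant, and
  the state covariance would be singular.

  Existence, uniqueness and monotonicity of the square root all rest on the eigenvector of a
  symmetric matrix at which its quadratic form is maximal on the unit sphere.
\<close>

section \<open>Quadratic forms and top eigenvectors\<close>

lemma inner_matrix_vector_transpose:
  fixes A :: "real^'n^'m"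
  shows "x \<bullet> (A *v y) = (transpose A *v x) \<bullet> y"
  by (metis dot_lmul_matrix vector_transpose_matrix transpose_transpose)

lemma symmetric_inner_commute:
  fixes A :: "real^'n^'n"
  assumes "transpose A = A"
  shows "x \<bullet> (A *v y) = y \<bullet> (A *v x)"
  using inner_matrix_vector_transpose[of x A y] assms by (simp add: inner_commute)

lemma symmetric_matrixI:
  fixes A :: "real^'n^'n"
  assumes "\<And>x y. x \<bullet> (A *v y) = y \<bullet> (A *v x)"
  shows "transpose A = A"
proof -
  have "x \<bullet> (transpose A *v y) = x \<bullet> (A *v y)" for x y
    using inner_matrix_vector_transpose[of y A x] assms[of x y] by (simp add: inner_commute)
  then have "transpose A *v y = A *v y" for y
    by (metis vector_eq_ldot)
  then show ?thesis
    by (simp add: matrix_eq)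
qed

lemma transpose_add: "transpose (A + B) = transpose A + transpose B"
  by (simp add: transpose_def vec_eq_iff)

lemma transpose_diff: "transpose (A - B) = transpose A - transpose B"
  by (simp add: transpose_def vec_eq_iff)

lemma psd_symmetric: "psd A \<Longrightarrow> transpose A = A"
  by (simp add: psd_def)

lemma psd_nonneg: "psd A \<Longrightarrow> 0 \<le> x \<bullet> (A *v x)"
  by (simp add: psd_def)

lemma pd_imp_psd: "pd A \<Longrightarrow> psd A"
  unfolding pd_def psd_def by (metis inner_zero_left less_imp_le order_refl)

lemma psd_add: "psd A \<Longrightarrow> psd B \<Longrightarrow> psd (A + B)"
  by (simp add: psd_def transpose_add matrix_vector_mult_add_rdistrib inner_add_right)

lemma psd_congruence:
  fixes C :: "real^'n^'m"
  assumes "psd A"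
  shows "psd (C ** A ** transpose C)"
  using assms unfolding psd_def
  by (simp add: matrix_transpose_mul matrix_vector_mul_assoc[symmetric] matrix_mul_assoc
      inner_matrix_vector_transpose[of _ C])

text \<open>
  If \<open>A x\<close> were nonzero, moving from \<open>x\<close> a small step against it would make the form negative, since
  the first-order term in the step size beats the second-order one.
\<close>

lemma psd_null_vector:
  fixes A :: "real^'n^'n"
  assumes "psd A" and "x \<bullet> (A *v x) = 0"
  shows "A *v x = 0"
proof (rule ccontr)
  assume nz: "A *v x \<noteq> 0"
  \<comment> \<open>The form at \<open>x + t y\<close> is \<open>2 t c + t\<^sup>2 d\<close>; the denominator \<open>d + 1\<close> of \<open>t\<close> avoids a case split on \<open>d = 0\<close>.\<close>
  define y where "y = A *v x"
  define c where "c = y \<bullet> y"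
  define d where "d = y \<bullet> (A *v y)"
  define t where "t = - (c / (d + 1))"
  have c: "c > 0" using nz by (simp add: c_def y_def)
  have d: "d \<ge> 0" using psd_nonneg[OF assms(1)] by (simp add: d_def)
  have xy: "x \<bullet> (A *v y) = c"
    using symmetric_inner_commute[OF psd_symmetric[OF assms(1)], of x y] by (simp add: c_def y_def)
  have "0 \<le> (x + t *\<^sub>R y) \<bullet> (A *v (x + t *\<^sub>R y))"
    by (rule psd_nonneg[OF assms(1)])
  also have "\<dots> = 2 * t * c + t\<^sup>2 * d"
    using xy assms(2)
    by (simp add: matrix_vector_right_distrib matrix_vector_mult_scaleR inner_add_left
        inner_add_right power2_eq_square d_def[symmetric])
      (simp add: y_def[symmetric] c_def[symmetric] algebra_simps)
  also have "\<dots> = - (c\<^sup>2 * (d + 2) / (d + 1)\<^sup>2)"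
    using d unfolding t_def power2_eq_square by (simp add: divide_simps) (simp add: algebra_simps)
  also have "\<dots> < 0"
    using c d by simp
  finally show False by simp
qed

lemma psd_zero_form_imp_zero:
  fixes A :: "real^'n^'n"
  assumes "psd A" and "\<And>x. x \<bullet> (A *v x) = 0"
  shows "A = 0"
  using psd_null_vector[OF assms] by (simp add: matrix_eq)

lemma continuous_on_quadratic_form:
  "continuous_on S (\<lambda>x. x \<bullet> ((A::real^'n^'n) *v x))"
  by (intro continuous_intros linear_continuous_on) (rule matrix_vector_mul_bounded_linear)

text \<open>
  A maximizer \<open>x\<close> of the form on the compact unit sphere, with value \<open>\<mu>\<close>, makes \<open>\<mu> I - A\<close> positive
  semidefinite with \<open>x\<close> a zero of its form, so \<open>x\<close> lies in the kernel of \<open>\<mu> I - A\<close>.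
\<close>

lemma top_eigenvector:
  fixes A :: "real^'n^'n"
  assumes sym: "transpose A = A"
  obtains x \<mu> where "norm x = 1" and "A *v x = \<mu> *\<^sub>R x" and "\<And>v. v \<bullet> (A *v v) \<le> \<mu> * (v \<bullet> v)"
proof -
  have "sphere (0::real^'n) 1 \<noteq> {}" by simp
  then obtain x where x: "norm x = 1"
    and max: "\<And>y. norm y = 1 \<Longrightarrow> y \<bullet> (A *v y) \<le> x \<bullet> (A *v x)"
    using continuous_attains_sup[OF compact_sphere _ continuous_on_quadratic_form, of 0 1 A]
    by auto
  define \<mu> where "\<mu> = x \<bullet> (A *v x)"
  have bound: "v \<bullet> (A *v v) \<le> \<mu> * (v \<bullet> v)" for v
  proof (cases "v = 0")
    case False
    have "(v /\<^sub>R norm v) \<bullet> (A *v (v /\<^sub>R norm v)) \<le> \<mu>"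
      unfolding \<mu>_def using False by (intro max) simp
    also have "(v /\<^sub>R norm v) \<bullet> (A *v (v /\<^sub>R norm v)) = (v \<bullet> (A *v v)) / (v \<bullet> v)"
      by (simp add: matrix_vector_mult_scaleR dot_square_norm power2_eq_square divide_simps)
    finally show ?thesis
      using False by (simp add: divide_le_eq)
  qed simp
  have E: "(mat \<mu> - A) *v v = \<mu> *\<^sub>R v - A *v v" for v
  proof -
    have "mat \<mu> *v v = \<mu> *\<^sub>R v"
      by (simp add: matrix_vector_mult_def mat_def vec_eq_iff if_distrib[where f="\<lambda>c. c * _"]
          cong: if_cong)
    then show ?thesis by (simp add: matrix_vector_mult_diff_rdistrib)
  qed
  have "psd (mat \<mu> - A)"
    unfolding psd_def using bound sym
    by (simp add: transpose_diff transpose_mat E inner_diff_right)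
  moreover have "x \<bullet> ((mat \<mu> - A) *v x) = 0"
    using x by (simp add: E inner_diff_right dot_square_norm \<mu>_def[symmetric])
  ultimately have "(mat \<mu> - A) *v x = 0"
    by (rule psd_null_vector)
  then have "A *v x = \<mu> *\<^sub>R x" by (simp add: E)
  with x bound that show ?thesis by blast
qed

section \<open>Square roots\<close>

text \<open>
  The hypothesis is \<open>L\<^sup>2 \<le> G\<^sup>2\<close>. At the top eigenvector \<open>x\<close> of \<open>L - G\<close>, with eigenvalue \<open>\<mu>\<close>, the form of
  \<open>L\<^sup>2 - G\<^sup>2\<close> equals \<open>\<mu>\<close> times that of \<open>L + G\<close>. A positive \<open>\<mu>\<close> would force both forms to vanish at \<open>x\<close>,
  and hence \<open>\<mu> = 0\<close>. So no eigenvalue of \<open>L - G\<close> is positive.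
\<close>

lemma psd_sqrt_mono:
  fixes L G :: "real^'n^'n"
  assumes L: "psd L" and G: "psd G"
    and le: "\<And>u. norm (L *v u) \<le> norm (G *v u)"
  shows "v \<bullet> (L *v v) \<le> v \<bullet> (G *v v)"
proof -
  have "transpose (L - G) = L - G"
    using L G by (simp add: transpose_diff psd_symmetric)
  then obtain x \<mu> where x: "norm x = 1" and ev: "(L - G) *v x = \<mu> *\<^sub>R x"
    and bound: "\<And>v. v \<bullet> ((L - G) *v v) \<le> \<mu> * (v \<bullet> v)"
    by (rule top_eigenvector) blast
  have "\<mu> \<le> 0"
  proof (rule ccontr)
    assume "\<not> \<mu> \<le> 0"
    then have pos: "\<mu> > 0" by simp
    define a where "a = x \<bullet> (L *v x)"
    define b where "b = x \<bullet> (G *v x)"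
    have ab: "a \<ge> 0" "b \<ge> 0" using psd_nonneg[OF L] psd_nonneg[OF G] by (auto simp: a_def b_def)
    have diff: "L *v x - G *v x = \<mu> *\<^sub>R x"
      using ev by (simp add: matrix_vector_mult_diff_rdistrib)
    have "(norm (L *v x))\<^sup>2 - (norm (G *v x))\<^sup>2 = (L *v x - G *v x) \<bullet> (L *v x + G *v x)"
      by (simp add: power2_norm_eq_inner inner_diff_left inner_add_right
          inner_commute[of "G *v x" "L *v x"])
    also have "\<dots> = \<mu> * (a + b)"
      unfolding diff by (simp add: a_def b_def inner_add_right distrib_left)
    finally have "\<mu> * (a + b) \<le> 0"
      using power_mono[OF le[of x] norm_ge_zero, of 2] by linarith
    with pos ab have "a = 0" "b = 0"
      by (auto simp: mult_le_0_iff)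
    moreover have "a - b = \<mu>"
      using arg_cong[OF diff, of "\<lambda>y. x \<bullet> y"] x
      by (simp add: a_def b_def inner_diff_right dot_square_norm)
    ultimately show False using pos by simp
  qed
  then have "\<mu> * (v \<bullet> v) \<le> 0"
    by (simp add: mult_nonpos_nonneg)
  with bound[of v] show ?thesis
    by (simp add: matrix_vector_mult_diff_rdistrib inner_diff_right)
qed

lemma norm_psd_square:
  fixes L :: "real^'n^'n"
  assumes "psd L"
  shows "(norm (L *v u))\<^sup>2 = u \<bullet> ((L ** L) *v u)"
  using assms
  by (simp add: power2_norm_eq_inner matrix_vector_mul_assoc[symmetric]
      inner_matrix_vector_transpose[of u] psd_symmetric)

lemma psd_sqrt_unique:
  fixes L G :: "real^'n^'n"
  assumes L: "psd L" and G: "psd G" and eq: "L ** L = G ** G"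
  shows "L = G"
proof -
  have "norm (L *v u) = norm (G *v u)" for u
    using norm_psd_square[OF L, of u] norm_psd_square[OF G, of u] eq
    by (metis norm_ge_zero power2_eq_iff_nonneg)
  then have form: "v \<bullet> (L *v v) = v \<bullet> (G *v v)" for v
    using psd_sqrt_mono[OF L G, of v] psd_sqrt_mono[OF G L, of v] by simp
  then have "psd (L - G)"
    using L G by (simp add: psd_def transpose_diff matrix_vector_mult_diff_rdistrib inner_diff_right)
  then have "L - G = 0"
    by (rule psd_zero_form_imp_zero) (simp add: form matrix_vector_mult_diff_rdistrib inner_diff_right)
  then show ?thesis by simp
qed

definition rank_one :: "real \<Rightarrow> real^'n \<Rightarrow> real^'n^'n" where
  "rank_one c x = (\<chi> i j. c * x $ i * x $ j)"

lemma rank_one_mult_vec: "rank_one c x *v z = (c * (x \<bullet> z)) *\<^sub>R x"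
  by (simp add: rank_one_def matrix_vector_mult_def inner_vec_def vec_eq_iff sum_distrib_left
      sum_distrib_right mult_ac)

lemma transpose_rank_one: "transpose (rank_one c x) = rank_one c x"
  by (simp add: rank_one_def transpose_def vec_eq_iff mult_ac)

lemma psd_rank_one: "0 \<le> c \<Longrightarrow> psd (rank_one c x)"
  by (simp add: psd_def transpose_rank_one rank_one_mult_vec inner_commute[of _ x]
      mult.assoc)

text \<open>
  Deflation: subtracting \<open>\<mu> x x\<^sup>T\<close> for the top unit eigenvector \<open>x\<close> leaves a positive semidefinite
  matrix with a larger kernel. Its root \<open>Y\<close> kills \<open>x\<close>, so \<open>(Y + sqrt \<mu> x x\<^sup>T)\<^sup>2\<close> has no cross terms.
\<close>

lemma psd_sqrt_exists:
  fixes X :: "real^'n^'n"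
  assumes "psd X"
  shows "\<exists>Y. psd Y \<and> Y ** Y = X"
  using assms
proof (induction "CARD('n) - dim {z. X *v z = 0}" arbitrary: X rule: less_induct)
  case less
  note X = less.prems
  obtain x \<mu> where x: "norm x = 1" and ev: "X *v x = \<mu> *\<^sub>R x"
    and bound: "\<And>v. v \<bullet> (X *v v) \<le> \<mu> * (v \<bullet> v)"
    using top_eigenvector[OF psd_symmetric[OF X]] by blast
  have xx: "x \<bullet> x = 1" using x by (simp add: dot_square_norm)
  have "\<mu> \<ge> 0" using psd_nonneg[OF X, of x] by (simp add: ev xx)
  show ?case
  proof (cases "\<mu> = 0")
    case True
    have "X = 0"
      using psd_nonneg[OF X] bound True by (intro psd_zero_form_imp_zero[OF X]) (simp add: order_antisym)
    then show ?thesis using X by (intro exI[of _ 0]) simp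
  next
    case False
    with \<open>\<mu> \<ge> 0\<close> have pos: "\<mu> > 0" by simp
    define X' where "X' = X - rank_one \<mu> x"
    have X'v: "X' *v z = X *v z - (\<mu> * (x \<bullet> z)) *\<^sub>R x" for z
      by (simp add: X'_def matrix_vector_mult_diff_rdistrib rank_one_mult_vec)
    have xX: "x \<bullet> (X *v z) = \<mu> * (x \<bullet> z)" for z
      using symmetric_inner_commute[OF psd_symmetric[OF X], of x z] by (simp add: ev inner_commute)
    have "psd X'"
      unfolding psd_def
    proof (intro conjI allI)
      show "transpose X' = X'"
        by (simp add: X'_def transpose_diff transpose_rank_one psd_symmetric[OF X])
      fix z
      \<comment> \<open>The form of the deflated matrix at \<open>z\<close> is that of \<open>X\<close> at the part of \<open>z\<close> orthogonal to \<open>x\<close>.\<close>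
      let ?z = "z - (x \<bullet> z) *\<^sub>R x"
      have "0 \<le> ?z \<bullet> (X *v ?z)" by (rule psd_nonneg[OF X])
      also have "\<dots> = z \<bullet> (X' *v z)"
        by (simp add: X'v matrix_vector_mult_diff_distrib matrix_vector_mult_scaleR inner_diff_left
            inner_diff_right xX ev xx inner_commute[of z x])
      finally show "0 \<le> z \<bullet> (X' *v z)" .
    qed
    have X'x: "X' *v x = 0" by (simp add: X'v ev xx)
    have sub: "subspace {z. Y *v z = 0}" for Y :: "real^'n^'n"
      by (auto simp: subspace_def matrix_vector_right_distrib matrix_vector_mult_scaleR)
    have "{z. X *v z = 0} \<subset> {z. X' *v z = 0}"
    proof
      show "{z. X *v z = 0} \<subseteq> {z. X' *v z = 0}"
        proof safe
        fix z assume "X *v z = 0"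
        then show "X' *v z = 0" using xX[of z] by (simp add: X'v)
      qed
      have "X *v x \<noteq> 0" using pos x by (auto simp: ev)
      with X'x show "{z. X *v z = 0} \<noteq> {z. X' *v z = 0}" by blast
    qed
    then have "dim {z. X *v z = 0} < dim {z. X' *v z = 0}"
      by (metis dim_psubset span_eq_iff sub)
    moreover have "dim {z. X' *v z = 0} \<le> CARD('n)"
      by (metis dim_subset_UNIV_cart)
    ultimately have "CARD('n) - dim {z. X' *v z = 0} < CARD('n) - dim {z. X *v z = 0}"
      by (intro diff_less_mono2) auto
    from less.hyps[OF this \<open>psd X'\<close>] obtain Y where Y: "psd Y" "Y ** Y = X'" by blast
    have "Y *v x = 0"
      using norm_psd_square[OF Y(1), of x] Y(2) X'x by simp
    then have xY: "x \<bullet> (Y *v z) = 0" for z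
      using symmetric_inner_commute[OF psd_symmetric[OF Y(1)], of x z] by simp
    let ?Y = "Y + rank_one (sqrt \<mu>) x"
    have "?Y ** ?Y = X"
    proof -
      have "(?Y ** ?Y) *v z = X *v z" for z
      proof -
        have "(?Y ** ?Y) *v z = (Y ** Y) *v z + (\<mu> * (x \<bullet> z)) *\<^sub>R x"
          using pos
          by (simp add: matrix_vector_mul_assoc[symmetric] matrix_vector_mult_add_rdistrib
            matrix_vector_right_distrib rank_one_mult_vec inner_add_right xY xx \<open>Y *v x = 0\<close>
            matrix_vector_mult_scaleR mult.assoc[symmetric])
        then show ?thesis by (simp add: Y(2) X'v)
      qed
      then show ?thesis by (simp add: matrix_eq)
    qed
    moreover have "psd ?Y"
      using Y(1) \<open>\<mu> \<ge> 0\<close> by (intro psd_add psd_rank_one) auto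
    ultimately show ?thesis by blast
  qed
qed

lemma mat_sqrt:
  fixes X :: "real^'n^'n"
  assumes "psd X"
  shows psd_mat_sqrt: "psd (mat_sqrt X)" and mat_sqrt_square: "mat_sqrt X ** mat_sqrt X = X"
proof -
  have "\<exists>!Y. psd Y \<and> Y ** Y = X"
    using psd_sqrt_exists[OF assms] psd_sqrt_unique by blast
  from theI'[OF this] show "psd (mat_sqrt X)" "mat_sqrt X ** mat_sqrt X = X"
    by (simp_all add: mat_sqrt_def)
qed

lemma trace_mono:
  fixes A B :: "real^'n^'n"
  assumes "\<And>v. v \<bullet> (A *v v) \<le> v \<bullet> (B *v v)"
  shows "trace A \<le> trace B"
proof -
  have "axis i 1 \<bullet> (C *v axis i 1) = C $ i $ i" for C :: "real^'n^'n" and i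
    by (simp add: inner_axis' matrix_vector_mul_component inner_axis)
  with assms[of "axis _ 1"] show ?thesis
    unfolding trace_def by (intro sum_mono) simp
qed

section \<open>Inverses and block matrices\<close>

lemma matrix_inv:
  fixes A :: "real^'n^'n"
  assumes "\<And>x. A *v x = 0 \<Longrightarrow> x = 0"
  shows matrix_inv_right: "A ** matrix_inv A = mat 1" and matrix_inv_left: "matrix_inv A ** A = mat 1"
proof -
  have "\<exists>B. B ** A = mat 1"
    using assms by (simp add: matrix_left_invertible_ker)
  then have "\<exists>B. A ** B = mat 1 \<and> B ** A = mat 1"
    by (metis matrix_left_right_inverse)
  from someI_ex[OF this] show "A ** matrix_inv A = mat 1" "matrix_inv A ** A = mat 1"
    by (simp_all add: matrix_inv_def)
qed

lemma pd_inverse: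
  fixes A :: "real^'n^'n"
  assumes "pd A"
  shows "A ** matrix_inv A = mat 1" and "matrix_inv A ** A = mat 1"
    and "transpose (matrix_inv A) = matrix_inv A"
proof -
  have "x = 0" if "A *v x = 0" for x
    using assms that unfolding pd_def by (metis inner_zero_right less_irrefl)
  note inv = matrix_inv[OF this]
  show "A ** matrix_inv A = mat 1" "matrix_inv A ** A = mat 1"
    by (rule inv, assumption)+
  have "transpose (matrix_inv A) ** A = mat 1"
    using assms inv(1) by (metis matrix_transpose_mul pd_def transpose_mat)
  then show "transpose (matrix_inv A) = matrix_inv A"
    by (metis inv(1) matrix_mul_assoc matrix_mul_lid matrix_mul_rid)
qed

lemma pd_mat_sqrt:
  fixes A :: "real^'n^'n"
  assumes "pd A"
  shows "pd (mat_sqrt A)"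
  unfolding pd_def
proof (intro conjI allI impI)
  note S = mat_sqrt[OF pd_imp_psd[OF assms]]
  show "transpose (mat_sqrt A) = mat_sqrt A" by (rule psd_symmetric[OF S(1)])
  fix x :: "real^'n" assume "x \<noteq> 0"
  then have "mat_sqrt A *v x \<noteq> 0"
    using norm_psd_square[OF S(1), of x] S(2) assms by (auto simp: pd_def)
  then show "0 < x \<bullet> (mat_sqrt A *v x)"
    using psd_null_vector[OF S(1), of x] psd_nonneg[OF S(1), of x] by force
qed

definition stack :: "real^'r \<Rightarrow> real^'s \<Rightarrow> real^('r + 's)" where
  "stack x y = (\<chi> i. case i of Inl r \<Rightarrow> x $ r | Inr s \<Rightarrow> y $ s)"

lemma stack_surj:
  obtains x y where "z = stack x y"
proof
  show "z = stack (\<chi> r. z $ Inl r) (\<chi> s. z $ Inr s)"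
    by (simp add: stack_def vec_eq_iff split: sum.split)
qed

lemma sum_UNIV_Plus:
  fixes f :: "'a::finite + 'b::finite \<Rightarrow> 'c::comm_monoid_add"
  shows "sum f UNIV = (\<Sum>a\<in>UNIV. f (Inl a)) + (\<Sum>b\<in>UNIV. f (Inr b))"
  by (subst UNIV_Plus_UNIV[symmetric], subst sum.Plus) simp_all

lemma block_mat_mult_stack:
  "block_mat X Y Z U *v stack x y = stack (X *v x + Y *v y) (Z *v x + U *v y)"
  by (simp add: block_mat_def stack_def matrix_vector_mult_def vec_eq_iff sum_UNIV_Plus
      split: sum.split)

lemma inner_stack: "stack x y \<bullet> stack x' y' = x \<bullet> x' + y \<bullet> y'"
  by (simp add: stack_def inner_vec_def sum_UNIV_Plus)

text \<open>
  Testing the block matrix on split vectors reduces each linear matrix inequality to the sign of a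
  quadratic polynomial in \<open>x\<close> and \<open>y\<close>, in which a square can be completed.
\<close>

lemma psd_block_iff:
  fixes X :: "real^'r^'r" and Y :: "real^'s^'r" and U :: "real^'s^'s"
  assumes "transpose X = X" and "transpose U = U"
  shows "psd (block_mat X Y (transpose Y) U) \<longleftrightarrow>
    (\<forall>x y. 0 \<le> x \<bullet> (X *v x) + 2 * (x \<bullet> (Y *v y)) + y \<bullet> (U *v y))"
proof -
  let ?B = "block_mat X Y (transpose Y) U"
  have sym: "transpose ?B = ?B"
    using assms
    by (auto simp: block_mat_def transpose_def vec_eq_iff split: sum.split)
  have form: "stack x y \<bullet> (?B *v stack x y) = x \<bullet> (X *v x) + 2 * (x \<bullet> (Y *v y)) + y \<bullet> (U *v y)" for x y
    using inner_matrix_vector_transpose[of x Y y]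
    by (simp add: block_mat_mult_stack inner_stack inner_add_right inner_commute)
  show ?thesis
    unfolding psd_def by (metis sym form stack_surj)
qed

section \<open>Square-integrable random vectors\<close>

definition square_integrable :: "'w measure \<Rightarrow> ('w \<Rightarrow> real^'n) \<Rightarrow> bool" where
  "square_integrable M X \<longleftrightarrow> X \<in> borel_measurable M \<and> integrable M (\<lambda>\<omega>. (norm (X \<omega>))\<^sup>2)"

lemma square_integrable_const: "prob_space M \<Longrightarrow> square_integrable M (\<lambda>_. c)"
  unfolding square_integrable_def
  by (simp add: finite_measure.integrable_const prob_space.finite_measure)

lemma square_integrable_add:
  assumes "square_integrable M X" and "square_integrable M Y"
  shows "square_integrable M (\<lambda>\<omega>. X \<omega> + Y \<omega>)"
proof -
  have [measurable]: "X \<in> borel_measurable M" "Y \<in> borel_measurable M"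
    using assms by (auto simp: square_integrable_def)
  have le: "(norm (X \<omega> + Y \<omega>))\<^sup>2 \<le> 2 * (norm (X \<omega>))\<^sup>2 + 2 * (norm (Y \<omega>))\<^sup>2" for \<omega>
  proof -
    have "(norm (X \<omega> + Y \<omega>))\<^sup>2 \<le> (norm (X \<omega>) + norm (Y \<omega>))\<^sup>2"
      by (simp add: norm_triangle_ineq power_mono)
    also have "\<dots> \<le> 2 * (norm (X \<omega>))\<^sup>2 + 2 * (norm (Y \<omega>))\<^sup>2"
      using sum_squares_bound[of "norm (X \<omega>)" "norm (Y \<omega>)"] by (simp add: power2_sum)
    finally show ?thesis .
  qed
  have "integrable M (\<lambda>\<omega>. 2 * (norm (X \<omega>))\<^sup>2 + 2 * (norm (Y \<omega>))\<^sup>2)"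
    using assms by (simp add: square_integrable_def)
  then have "integrable M (\<lambda>\<omega>. (norm (X \<omega> + Y \<omega>))\<^sup>2)"
    by (rule Bochner_Integration.integrable_bound) (auto simp: le intro!: AE_I2 order_trans[OF le])
  then show ?thesis
    by (simp add: square_integrable_def)
qed

lemma square_integrable_matrix_mult:
  fixes A :: "real^'n^'m"
  assumes "square_integrable M X"
  shows "square_integrable M (\<lambda>\<omega>. A *v X \<omega>)"
proof -
  have [measurable]: "X \<in> borel_measurable M"
    using assms by (simp add: square_integrable_def)
  have [measurable]: "(\<lambda>\<omega>. A *v X \<omega>) \<in> borel_measurable M"
    by (rule measurable_compose[OF \<open>X \<in> borel_measurable M\<close> borel_measurable_continuous_onI])
      (rule linear_continuous_on[OF matrix_vector_mul_bounded_linear])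
  obtain c where c: "\<And>x. norm (A *v x) \<le> norm x * c"
    using bounded_linear.bounded[OF matrix_vector_mul_bounded_linear[of A]] by blast
  have le: "(norm (A *v X \<omega>))\<^sup>2 \<le> c\<^sup>2 * (norm (X \<omega>))\<^sup>2" for \<omega>
    using power_mono[OF c[of "X \<omega>"], of 2] by (simp add: power_mult_distrib mult.commute)
  have "integrable M (\<lambda>\<omega>. c\<^sup>2 * (norm (X \<omega>))\<^sup>2)"
    using assms by (simp add: square_integrable_def)
  then have "integrable M (\<lambda>\<omega>. (norm (A *v X \<omega>))\<^sup>2)"
    by (rule Bochner_Integration.integrable_bound) (auto simp: le)
  then show ?thesis
    by (simp add: square_integrable_def)
qed

lemma square_integrable_diff_const:
  assumes "prob_space M" and "square_integrable M X"
  shows "square_integrable M (\<lambda>\<omega>. X \<omega> - c)"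
  using square_integrable_add[OF assms(2) square_integrable_const[OF assms(1), of "- c"]] by simp

lemma square_integrable_sum:
  assumes "prob_space M" and "finite I" and "\<And>i. i \<in> I \<Longrightarrow> square_integrable M (X i)"
  shows "square_integrable M (\<lambda>\<omega>. \<Sum>i\<in>I. X i \<omega>)"
  using assms(2,3)
  by (induction I rule: finite_induct)
    (simp_all add: square_integrable_const[OF assms(1)] square_integrable_add)

lemma square_integrable_vec_imp_integrable:
  fixes X :: "'w \<Rightarrow> real^'n"
  assumes "prob_space M" and "square_integrable M X"
  shows "integrable M X"
proof -
  have [measurable]: "X \<in> borel_measurable M"
    using assms(2) by (simp add: square_integrable_def)
  have "integrable M (\<lambda>\<omega>. norm (X \<omega>))"
    by (rule finite_measure.square_integrable_imp_integrable[OF prob_space.finite_measure[OF assms(1)]])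
      (use assms(2) in \<open>auto simp: square_integrable_def\<close>)
  then show ?thesis
    by (rule integrable_norm_cancel) measurable
qed

lemma square_integrable_components:
  fixes Z :: "'w \<Rightarrow> real^'n"
  assumes "square_integrable M Z"
  shows "integrable M (\<lambda>\<omega>. Z \<omega> $ i * Z \<omega> $ j)"
proof -
  have [measurable]: "Z \<in> borel_measurable M"
    using assms by (simp add: square_integrable_def)
  have [measurable]: "(\<lambda>\<omega>. Z \<omega> $ k) \<in> borel_measurable M" for k
    by (rule measurable_compose[OF \<open>Z \<in> borel_measurable M\<close> borel_measurable_continuous_onI])
      (intro continuous_intros)
  have "integrable M (\<lambda>\<omega>. (norm (Z \<omega>))\<^sup>2)"
    using assms by (simp add: square_integrable_def)
  then show ?thesis
  proof (rule Bochner_Integration.integrable_bound)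
    show "AE \<omega> in M. norm (Z \<omega> $ i * Z \<omega> $ j) \<le> norm ((norm (Z \<omega>))\<^sup>2)"
      by (intro AE_I2) (simp add: abs_mult power2_eq_square mult_mono component_le_norm_cart)
  qed measurable
qed

text \<open>
  If \<open>y \<bullet> X\<close> is almost surely constant, then \<open>y\<close> is orthogonal to the centred vector, and entry \<open>i\<close> of
  the product is the expectation of \<open>Z\<^sub>i (y \<bullet> Z) = 0\<close>. Square integrability is what allows the finite
  sum to be moved inside the entrywise integrals.
\<close>

lemma covariance_mat_null_vector:
  fixes X :: "'w \<Rightarrow> real^'n"
  assumes M: "prob_space M" and X: "square_integrable M X"
    and const: "AE \<omega> in M. y \<bullet> X \<omega> = c"
  shows "covariance_mat M X *v y = 0"
proof -
  interpret prob_space M by (rule M)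
  define Z where "Z = (\<lambda>\<omega>. X \<omega> - integral\<^sup>L M X)"
  note int = square_integrable_vec_imp_integrable[OF M X]
  have [measurable]: "X \<in> borel_measurable M"
    using X by (simp add: square_integrable_def)
  have "y \<bullet> integral\<^sup>L M X = (\<integral>\<omega>. y \<bullet> X \<omega> \<partial>M)"
    using int by simp
  also have "\<dots> = (\<integral>\<omega>. c \<partial>M)"
    using const by (intro integral_cong_AE) auto
  finally have mean: "y \<bullet> integral\<^sup>L M X = c"
    by (simp add: prob_space)
  have Z: "square_integrable M Z"
    unfolding Z_def by (rule square_integrable_diff_const[OF M X])
  have zero: "(\<Sum>j\<in>UNIV. (\<integral>\<omega>. Z \<omega> $ i * Z \<omega> $ j \<partial>M) * y $ j) = 0" for i
  proof -
    have "(\<Sum>j\<in>UNIV. (\<integral>\<omega>. Z \<omega> $ i * Z \<omega> $ j \<partial>M) * y $ j) =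
        (\<integral>\<omega>. (\<Sum>j\<in>UNIV. Z \<omega> $ i * Z \<omega> $ j * y $ j) \<partial>M)"
      using square_integrable_components[OF Z] by simp
    also have "\<dots> = (\<integral>\<omega>. Z \<omega> $ i * (y \<bullet> Z \<omega>) \<partial>M)"
      by (simp add: inner_vec_def sum_distrib_left mult_ac)
    also have "\<dots> = 0"
      using const mean by (intro integral_eq_zero_AE) (auto simp: Z_def inner_diff_right elim!: eventually_mono)
    finally show ?thesis .
  qed
  show ?thesis
    using zero by (simp add: covariance_mat_def matrix_vector_mult_def vec_eq_iff Z_def)
qed

section \<open>Gaussian noise and the state process\<close>

lemma gaussian_degenerate:
  assumes X: "gaussian_rv M X m S" and a: "a \<bullet> (S *v a) = 0"
  shows "AE \<omega> in M. a \<bullet> X \<omega> = a \<bullet> m"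
proof -
  have [measurable]: "X \<in> borel_measurable M"
    using X by (simp add: gaussian_rv_def)
  have "distr M borel (\<lambda>\<omega>. a \<bullet> X \<omega>) = return borel (a \<bullet> m)"
    using X a by (simp add: gaussian_rv_def)
  then have "AE t in distr M borel (\<lambda>\<omega>. a \<bullet> X \<omega>). t = a \<bullet> m"
    by (simp only:) (subst AE_return, auto)
  then show ?thesis
    by (subst (asm) AE_distr_iff) auto
qed

text \<open>
  The squared norm is the sum of the squared marginals along the axes; each of them is almost surely
  constant or has a normal density.
\<close>

lemma gaussian_square_integrable:
  fixes X :: "'w \<Rightarrow> real^'n"
  assumes M: "prob_space M" and X: "gaussian_rv M X m S" and S: "psd S"
  shows "square_integrable M X"
proof -
  interpret prob_space M by (rule M)
  have [measurable]: "X \<in> borel_measurable M"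
    using X by (simp add: gaussian_rv_def)
  have marginal: "integrable M (\<lambda>\<omega>. (a \<bullet> X \<omega>)\<^sup>2)" for a
  proof (cases "a \<bullet> (S *v a) = 0")
    case True
    have "integrable M (\<lambda>\<omega>. (a \<bullet> m)\<^sup>2)" by simp
    moreover have "AE \<omega> in M. (a \<bullet> m)\<^sup>2 = (a \<bullet> X \<omega>)\<^sup>2"
      using gaussian_degenerate[OF X True] by (auto elim!: eventually_mono)
    ultimately show ?thesis
      by (subst (asm) integrable_cong_AE) auto
  next
    case False
    define c where "c = a \<bullet> m"
    define s where "s = sqrt (a \<bullet> (S *v a))"
    have "s > 0" using False psd_nonneg[OF S, of a] by (simp add: s_def)
    note moment = integrable_normal_moment[OF this, of c]
    \<comment> \<open>Expansion of \<open>t\<^sup>2\<close> around the mean \<open>c\<close>.\<close>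
    have "integrable lborel (\<lambda>t. normal_density c s t * (t - c)^2 +
        2 * c * (normal_density c s t * (t - c)^1) + c\<^sup>2 * (normal_density c s t * (t - c)^0))"
      by (intro Bochner_Integration.integrable_add integrable_mult_right moment)
    also have "(\<lambda>t. normal_density c s t * (t - c)^2 +
        2 * c * (normal_density c s t * (t - c)^1) + c\<^sup>2 * (normal_density c s t * (t - c)^0)) =
        (\<lambda>t. normal_density c s t *\<^sub>R t\<^sup>2)"
      by (simp add: fun_eq_iff power2_eq_square algebra_simps)
    finally have "integrable (density lborel (normal_density c s)) (\<lambda>t. t\<^sup>2)"
      by (subst integrable_density) (auto simp: normal_density_nonneg)
    also have "density lborel (normal_density c s) = distr M borel (\<lambda>\<omega>. a \<bullet> X \<omega>)"
      using X False by (simp add: gaussian_rv_def c_def s_def)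
    finally show ?thesis
      by (subst (asm) integrable_distr_eq) auto
  qed
  have "(norm (X \<omega>))\<^sup>2 = (\<Sum>i\<in>UNIV. (axis i 1 \<bullet> X \<omega>)\<^sup>2)" for \<omega>
    by (simp add: norm_vec_def L2_set_def sum_nonneg inner_axis')
  with marginal show ?thesis
    by (simp add: square_integrable_def)
qed

lemma state_square_integrable:
  fixes A :: "nat \<Rightarrow> real^'n^'n"
  assumes noise: "system_noise M N \<mu>0 \<Sigma>0 W x0 w"
    and "psd \<Sigma>0" and W: "\<And>k. k < N \<Longrightarrow> psd (W k)" and "k \<le> N"
  shows "square_integrable M (state M A B x0 w v K k)"
  using \<open>k \<le> N\<close>
proof (induction k rule: less_induct)
  case (less k)
  have M: "prob_space M" using noise by (simp add: system_noise_def)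
  show ?case
  proof (cases k)
    case 0
    then show ?thesis
      using noise gaussian_square_integrable[OF M _ \<open>psd \<Sigma>0\<close>, of x0 \<mu>0]
      by (simp add: system_noise_def)
  next
    case (Suc j)
    have "square_integrable M (w j)"
      using noise less.prems Suc
      by (intro gaussian_square_integrable[OF M, of "w j" 0 "W j"] W) (auto simp: system_noise_def)
    moreover have "square_integrable M (state M A B x0 w v K i)" if "i \<le> j" for i
      using less that Suc by simp
    ultimately show ?thesis
      unfolding Suc state.simps
      by (intro square_integrable_add square_integrable_matrix_mult square_integrable_const
          square_integrable_sum square_integrable_diff_const M) auto
  qed
qed

text \<open>
  A null direction \<open>y\<close> of the new covariance would also be one of a state covariance, which
  is excluded: \<open>y \<bullet> x\<^bsub>k+1\<^esub>\<close> depends on the past through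
  \<open>(A\<^sub>k + B\<^sub>k G)\<^sup>T y = 0\<close>, and on the noise through \<open>y \<bullet> w\<^sub>k\<close>, which has variance zero.
\<close>

lemma covariance_step_pd:
  fixes A :: "nat \<Rightarrow> real^'n^'n" and B :: "nat \<Rightarrow> real^'m^'n"
  assumes noise: "system_noise M N \<mu>0 \<Sigma>0 W x0 w"
    and "psd \<Sigma>0" and W: "\<And>k. k < N \<Longrightarrow> psd (W k)"
    and nondegenerate: "\<And>v (K :: nat \<Rightarrow> nat \<Rightarrow> real^'n^'m) k.
      k \<le> N \<Longrightarrow> pd (covariance_mat M (state M A B x0 w v K k))"
    and "k < N" and S: "pd S" and Q: "psd Q"
  shows "pd ((A k + B k ** G) ** S ** transpose (A k + B k ** G) +
    B k ** Q ** transpose (B k) + W k)" (is "pd ?T")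
  unfolding pd_def
proof (intro conjI allI impI)
  have M: "prob_space M" using noise by (simp add: system_noise_def)
  define C where "C = A k + B k ** G"
  have T: "psd ?T"
    using \<open>k < N\<close> by (intro psd_add psd_congruence pd_imp_psd S Q W)
  then show "transpose ?T = ?T" by (rule psd_symmetric)
  fix y :: "real^'n" assume "y \<noteq> 0"
  show "0 < y \<bullet> (?T *v y)"
  proof (rule ccontr)
    assume "\<not> 0 < y \<bullet> (?T *v y)"
    then have "y \<bullet> (?T *v y) = 0" using psd_nonneg[OF T, of y] by simp
    then have sum0: "y \<bullet> ((C ** S ** transpose C) *v y) +
        y \<bullet> ((B k ** Q ** transpose (B k)) *v y) + y \<bullet> (W k *v y) = 0"
      by (simp add: C_def matrix_vector_mult_add_rdistrib inner_add_right)
    moreover have "0 \<le> y \<bullet> ((C ** S ** transpose C) *v y)"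
      by (intro psd_nonneg psd_congruence pd_imp_psd S)
    moreover have "0 \<le> y \<bullet> ((B k ** Q ** transpose (B k)) *v y)"
      by (intro psd_nonneg psd_congruence Q)
    moreover have "0 \<le> y \<bullet> (W k *v y)"
      by (intro psd_nonneg W \<open>k < N\<close>)
    ultimately have C0: "y \<bullet> ((C ** S ** transpose C) *v y) = 0" and W0: "y \<bullet> (W k *v y) = 0"
      by linarith+
    have Cy: "transpose C *v y = 0"
    proof (rule ccontr)
      assume "transpose C *v y \<noteq> 0"
      then have "0 < (transpose C *v y) \<bullet> (S *v (transpose C *v y))"
        using S by (simp add: pd_def)
      with C0 show False
        by (simp add: matrix_vector_mul_assoc[symmetric] inner_matrix_vector_transpose[of y C])
    qed
    \<comment> \<open>The gain acts on \<open>x\<^sub>k\<close> only, so at time \<open>k\<close> the feedback is \<open>G (x\<^sub>k - E x\<^sub>k)\<close>.\<close>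
    let ?X = "state M A B x0 w (\<lambda>_. 0) (\<lambda>_ \<tau>. if \<tau> = k then G else 0)"
    have policy: "(\<Sum>\<tau>\<le>k. (if \<tau> = k then G else 0) *v f \<tau>) = G *v f k" for f :: "nat \<Rightarrow> real^'n"
      by (subst sum.remove[of _ k]) auto
    have "?X (Suc k) \<omega> = C *v ?X k \<omega> - B k *v (G *v integral\<^sup>L M (?X k)) + w k \<omega>" for \<omega>
      unfolding state.simps policy
      by (simp add: C_def matrix_vector_mult_add_rdistrib matrix_vector_mul_assoc[symmetric]
          matrix_vector_mult_diff_distrib)
    then have "y \<bullet> ?X (Suc k) \<omega> = - (y \<bullet> (B k *v (G *v integral\<^sup>L M (?X k)))) + y \<bullet> w k \<omega>" for \<omega>
      using Cy by (simp add: inner_add_right inner_diff_right inner_matrix_vector_transpose[of y C])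
    moreover have "AE \<omega> in M. y \<bullet> w k \<omega> = y \<bullet> 0"
      by (rule gaussian_degenerate[OF _ W0]) (use noise \<open>k < N\<close> in \<open>auto simp: system_noise_def\<close>)
    ultimately have "AE \<omega> in M. y \<bullet> ?X (Suc k) \<omega> = - (y \<bullet> (B k *v (G *v integral\<^sup>L M (?X k))))"
      by (auto elim!: eventually_mono)
    then have "covariance_mat M (?X (Suc k)) *v y = 0"
      using \<open>k < N\<close>
      by (intro covariance_mat_null_vector[OF M] state_square_integrable[OF noise \<open>psd \<Sigma>0\<close> W]) auto
    moreover have "pd (covariance_mat M (?X (Suc k)))"
      using \<open>k < N\<close> by (intro nondegenerate) simp
    ultimately show False
      using \<open>y \<noteq> 0\<close> unfolding pd_def by (metis inner_zero_right less_irrefl)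
  qed
qed

section \<open>Schur complements and the covariance recursion\<close>

lemma transpose_pd_gain:
  fixes P :: "real^'n^'m" and S :: "real^'n^'n"
  assumes "pd S" and "G = P ** matrix_inv S"
  shows "G ** S = P" and "G ** S ** transpose G = P ** matrix_inv S ** transpose P"
proof -
  note inv = pd_inverse[OF assms(1)]
  show GS: "G ** S = P"
    by (simp add: assms(2) matrix_mul_assoc[symmetric] inv)
  have SG: "S ** transpose G = transpose P"
    by (simp add: assms(2) matrix_transpose_mul matrix_mul_assoc inv)
  show "G ** S ** transpose G = P ** matrix_inv S ** transpose P"
    by (simp add: matrix_mul_assoc[symmetric] SG) (simp add: assms(2) matrix_mul_assoc)
qed

lemma matrix_add_rdistrib:
  fixes A B :: "real^'n^'m" and C :: "real^'k^'n"
  shows "(A + B) ** C = A ** C + B ** C"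
  by (simp add: matrix_eq matrix_vector_mul_assoc[symmetric] matrix_vector_mult_add_rdistrib)

lemma matrix_vector_mult_minus:
  fixes A :: "real^'n^'m"
  shows "A *v (- x) = - (A *v x)"
  using matrix_vector_mult_scaleR[of A "- 1" x] by simp

lemma trace_scaleR: "trace (c *\<^sub>R (A::real^'n^'n)) = c * trace A"
  by (simp add: trace_def sum_distrib_left)

text \<open>
  Expanding the closed-loop recursion in the products \<open>G S\<close> and \<open>G S G\<^sup>T + Q\<close> makes it linear; these
  products are the variables of the semidefinite problem.
\<close>

lemma covariance_update:
  fixes A S :: "real^'n^'n" and B :: "real^'m^'n" and G :: "real^'n^'m"
  assumes "transpose S = S"
  shows "A ** S ** transpose A + A ** transpose (G ** S) ** transpose B + B ** (G ** S) ** transpose A +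
      B ** (G ** S ** transpose G + Q) ** transpose B =
    (A + B ** G) ** S ** transpose (A + B ** G) + B ** Q ** transpose B"
  by (simp add: matrix_add_ldistrib matrix_add_rdistrib transpose_add matrix_transpose_mul assms
      matrix_mul_assoc algebra_simps)

text \<open>
  The block form is minimal in its second argument at \<open>y = - S\<^sup>-\<^sup>1 P\<^sup>T x\<close>, where its value is the form of the
  Schur complement at \<open>x\<close>.
\<close>

lemma schur_complement_psd:
  fixes S :: "real^'n^'n" and M :: "real^'m^'m"
  assumes S: "pd S" and M: "psd M" and block: "psd (block_mat M P (transpose P) S)"
  shows "psd (M - P ** matrix_inv S ** transpose P)"
proof -
  define G where "G = P ** matrix_inv S"
  note gain = transpose_pd_gain[OF S G_def]
  have form: "0 \<le> x \<bullet> (M *v x) + 2 * (x \<bullet> (P *v y)) + y \<bullet> (S *v y)" for x y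
    using block psd_block_iff[OF psd_symmetric[OF M] psd_symmetric[OF pd_imp_psd[OF S]]] by blast
  have "0 \<le> x \<bullet> ((M - P ** matrix_inv S ** transpose P) *v x)" for x
  proof -
    define q where "q = x \<bullet> ((G ** S ** transpose G) *v x)"
    define y where "y = - (transpose G *v x)"
    have "P *v y = - ((G ** S ** transpose G) *v x)"
      unfolding gain(1)[symmetric] y_def
      by (simp only: matrix_vector_mult_minus matrix_vector_mul_assoc)
    then have "x \<bullet> (P *v y) = - q" by (simp add: q_def)
    moreover have "y \<bullet> (S *v y) = q"
      by (simp add: q_def y_def matrix_vector_mult_minus inner_matrix_vector_transpose[of x G]
          matrix_vector_mul_assoc[symmetric])
    ultimately have "0 \<le> x \<bullet> (M *v x) - q" using form[of x y] by simp
    then show ?thesis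
      by (simp add: q_def gain(2) matrix_vector_mult_diff_rdistrib inner_diff_right)
  qed
  moreover have "transpose (M - P ** matrix_inv S ** transpose P) = M - P ** matrix_inv S ** transpose P"
    by (simp add: transpose_diff matrix_transpose_mul psd_symmetric[OF M] pd_inverse(3)[OF S] matrix_mul_assoc)
  ultimately show ?thesis by (simp add: psd_def)
qed

text \<open>
  Completing the square, the block form is that of \<open>S\<close> at \<open>G\<^sup>T x + y\<close> plus that of \<open>Q\<close> at \<open>x\<close>.
\<close>

lemma schur_block_psd:
  fixes S :: "real^'n^'n" and Q :: "real^'m^'m"
  assumes S: "psd S" and Q: "psd Q"
  shows "psd (G ** S ** transpose G + Q)"
    and "psd (block_mat (G ** S ** transpose G + Q) (G ** S) (transpose (G ** S)) S)"
proof -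
  show M: "psd (G ** S ** transpose G + Q)"
    by (intro psd_add psd_congruence S Q)
  have "x \<bullet> ((G ** S ** transpose G + Q) *v x) + 2 * (x \<bullet> ((G ** S) *v y)) + y \<bullet> (S *v y) =
      (transpose G *v x + y) \<bullet> (S *v (transpose G *v x + y)) + x \<bullet> (Q *v x)" for x y
    using symmetric_inner_commute[OF psd_symmetric[OF S], of y "transpose G *v x"]
    by (simp add: matrix_vector_mult_add_rdistrib matrix_vector_mul_assoc[symmetric]
        inner_matrix_vector_transpose[of x G] matrix_vector_right_distrib inner_add_left inner_add_right)
  then have "0 \<le> x \<bullet> ((G ** S ** transpose G + Q) *v x) + 2 * (x \<bullet> ((G ** S) *v y)) + y \<bullet> (S *v y)" for x y
    by (simp add: psd_nonneg[OF S] psd_nonneg[OF Q])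
  then show "psd (block_mat (G ** S ** transpose G + Q) (G ** S) (transpose (G ** S)) S)"
    using psd_block_iff[OF psd_symmetric[OF M] psd_symmetric[OF S]] by blast
qed

section \<open>The terminal constraint\<close>

text \<open>
  The block constraint on \<open>L\<close> amounts to \<open>L\<^sup>2 \<le> D\<^sup>1\<^sup>/\<^sup>2 S D\<^sup>1\<^sup>/\<^sup>2\<close>: substituting \<open>x = D\<^sup>1\<^sup>/\<^sup>2 u\<close> and completing
  the square in \<open>y\<close> leaves the difference of these forms at \<open>u\<close>, and \<open>D\<^sup>1\<^sup>/\<^sup>2\<close> is surjective.
\<close>

lemma bures_block_form:
  fixes S L :: "real^'n^'n" and D :: "real^'n^'n"
  assumes D: "pd D" and L: "transpose L = L"
    and S: "psd S"
  defines "Dh \<equiv> mat_sqrt D"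
  shows "psd (block_mat S (matrix_inv Dh ** L) (L ** matrix_inv Dh) (mat 1)) \<longleftrightarrow>
    (\<forall>u. (norm (L *v u))\<^sup>2 \<le> u \<bullet> ((Dh ** S ** Dh) *v u))"
proof -
  note Dh = pd_mat_sqrt[OF D, folded Dh_def]
  note inv = pd_inverse[OF Dh]
  have symDh: "transpose Dh = Dh" using Dh by (simp add: pd_def)
  have T: "L ** matrix_inv Dh = transpose (matrix_inv Dh ** L)"
    by (simp add: matrix_transpose_mul inv L)
  have form: "(Dh *v u) \<bullet> (S *v (Dh *v u)) + 2 * ((Dh *v u) \<bullet> ((matrix_inv Dh ** L) *v y)) + y \<bullet> (mat 1 *v y)
      = u \<bullet> ((Dh ** S ** Dh) *v u) - (norm (L *v u))\<^sup>2 + (norm (L *v u + y))\<^sup>2" for u y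
  proof -
    have "(Dh *v u) \<bullet> ((matrix_inv Dh ** L) *v y) = u \<bullet> (L *v y)"
    proof -
      have "(Dh *v u) \<bullet> ((matrix_inv Dh ** L) *v y) = u \<bullet> (Dh *v ((matrix_inv Dh ** L) *v y))"
        using inner_matrix_vector_transpose[of u Dh] symDh by simp
      then show ?thesis
        by (simp add: matrix_vector_mul_assoc matrix_mul_assoc inv)
    qed
    also have "\<dots> = (L *v u) \<bullet> y"
      using inner_matrix_vector_transpose[of u L y] L by simp
    finally have cross: "(Dh *v u) \<bullet> ((matrix_inv Dh ** L) *v y) = (L *v u) \<bullet> y" .
    have "(Dh *v u) \<bullet> (S *v (Dh *v u)) = u \<bullet> ((Dh ** S ** Dh) *v u)"
      using inner_matrix_vector_transpose[of u Dh] symDh by (simp add: matrix_vector_mul_assoc[symmetric])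
    then show ?thesis
      unfolding cross
      by (simp add: power2_norm_eq_inner inner_add_left inner_add_right inner_commute)
  qed
  have surj: "\<exists>u. x = Dh *v u" for x
    by (rule exI[of _ "matrix_inv Dh *v x"]) (simp add: matrix_vector_mul_assoc inv)
  have "psd (block_mat S (matrix_inv Dh ** L) (L ** matrix_inv Dh) (mat 1)) \<longleftrightarrow>
    (\<forall>u y. 0 \<le> u \<bullet> ((Dh ** S ** Dh) *v u) - (norm (L *v u))\<^sup>2 + (norm (L *v u + y))\<^sup>2)"
    unfolding T using psd_block_iff[OF psd_symmetric[OF S] transpose_mat] form surj by metis
  also have "\<dots> \<longleftrightarrow> (\<forall>u. (norm (L *v u))\<^sup>2 \<le> u \<bullet> ((Dh ** S ** Dh) *v u))"
  proof (intro iffI allI)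
    fix u assume "\<forall>u y. 0 \<le> u \<bullet> ((Dh ** S ** Dh) *v u) - (norm (L *v u))\<^sup>2 + (norm (L *v u + y))\<^sup>2"
    from this[rule_format, of u "- (L *v u)"]
    show "(norm (L *v u))\<^sup>2 \<le> u \<bullet> ((Dh ** S ** Dh) *v u)" by simp
  qed (simp add: add_increasing2)
  finally show ?thesis .
qed

lemma psd_sandwich:
  fixes D S :: "real^'n^'n"
  assumes "pd D" and "psd S"
  shows "psd (mat_sqrt D ** S ** mat_sqrt D)"
  using psd_congruence[OF assms(2), of "mat_sqrt D"] pd_mat_sqrt[OF assms(1)] by (simp add: pd_def)

text \<open>
  With \<open>bures_block_attained\<close>, this shows that the largest \<open>tr L\<close> over positive semidefinite \<open>L\<close>
  under the block constraint is the trace appearing in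
  the squared Bures (Gaussian Wasserstein) distance of \<open>S\<close> and \<open>D\<close>.
\<close>

lemma bures_trace_le:
  fixes D S L :: "real^'n^'n"
  assumes D: "pd D" and S: "psd S" and L: "psd L"
    and block: "psd (block_mat S (matrix_inv (mat_sqrt D) ** L) (L ** matrix_inv (mat_sqrt D)) (mat 1))"
  shows "trace L \<le> trace (mat_sqrt (mat_sqrt D ** S ** mat_sqrt D))"
proof (rule trace_mono, rule psd_sqrt_mono[OF L])
  note sq = mat_sqrt[OF psd_sandwich[OF D S]]
  show "psd (mat_sqrt (mat_sqrt D ** S ** mat_sqrt D))" by (rule sq)
  fix u
  have "(norm (L *v u))\<^sup>2 \<le> u \<bullet> ((mat_sqrt D ** S ** mat_sqrt D) *v u)"
    using block bures_block_form[OF D psd_symmetric[OF L] S] by blast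
  also have "\<dots> = (norm (mat_sqrt (mat_sqrt D ** S ** mat_sqrt D) *v u))\<^sup>2"
    by (simp add: norm_psd_square[OF sq(1)] sq(2))
  finally show "norm (L *v u) \<le> norm (mat_sqrt (mat_sqrt D ** S ** mat_sqrt D) *v u)"
    by (rule power2_le_imp_le) simp
qed

lemma bures_block_attained:
  fixes D S :: "real^'n^'n"
  assumes D: "pd D" and S: "psd S"
  defines "L \<equiv> mat_sqrt (mat_sqrt D ** S ** mat_sqrt D)"
  shows "psd (block_mat S (matrix_inv (mat_sqrt D) ** L) (L ** matrix_inv (mat_sqrt D)) (mat 1))"
proof -
  note sq = mat_sqrt[OF psd_sandwich[OF D S], folded L_def]
  show ?thesis
    unfolding bures_block_form[OF D psd_symmetric[OF sq(1)] S] by (simp add: norm_psd_square[OF sq(1)] sq(2))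
qed

section \<open>The two changes of variables\<close>

definition nlp_of_sdp :: "nat \<Rightarrow> ('n, 'm) sdp_point \<Rightarrow> ('n::finite, 'm::finite) nlp_point" where
  "nlp_of_sdp N s = \<lparr>nlp_v = sdp_v s,
     nlp_K = restrict (\<lambda>k. sdp_P s k ** matrix_inv (sdp_\<Sigma> s k)) {..<N},
     nlp_Q = restrict (\<lambda>k. sdp_M s k -
       sdp_P s k ** matrix_inv (sdp_\<Sigma> s k) ** transpose (sdp_P s k)) {..<N},
     nlp_\<mu> = sdp_\<mu> s, nlp_\<Sigma> = sdp_\<Sigma> s\<rparr>"

definition sdp_of_nlp ::
  "nat \<Rightarrow> real^'n^'n \<Rightarrow> ('n, 'm) nlp_point \<Rightarrow> ('n::finite, 'm::finite) sdp_point" where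
  "sdp_of_nlp N \<Sigma>d z = \<lparr>sdp_v = nlp_v z,
     sdp_P = restrict (\<lambda>k. nlp_K z k ** nlp_\<Sigma> z k) {..<N},
     sdp_M = restrict (\<lambda>k. nlp_K z k ** nlp_\<Sigma> z k ** transpose (nlp_K z k) + nlp_Q z k) {..<N},
     sdp_\<mu> = nlp_\<mu> z, sdp_\<Sigma> = nlp_\<Sigma> z,
     sdp_L = mat_sqrt (mat_sqrt \<Sigma>d ** nlp_\<Sigma> z N ** mat_sqrt \<Sigma>d)\<rparr>"

text \<open>
  Dictionary for one time step: read through the gain \<open>G\<close> and the Schur complement \<open>Q\<close>, the linear
  recursion of the semidefinite problem is the closed-loop one, and \<open>M\<^sub>k\<close> is the control covariance.
\<close>

lemma sdp_covariance_recursion: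
  assumes s: "sdp_feasible N A B W \<mu>0 \<Sigma>0 \<Sigma>d s" and "k < N" and pd: "pd (sdp_\<Sigma> s k)"
  defines "G \<equiv> sdp_P s k ** matrix_inv (sdp_\<Sigma> s k)"
  defines "Q \<equiv> sdp_M s k - sdp_P s k ** matrix_inv (sdp_\<Sigma> s k) ** transpose (sdp_P s k)"
  shows "psd Q" and "sdp_M s k = G ** sdp_\<Sigma> s k ** transpose G + Q"
    and "sdp_\<Sigma> s (Suc k) = (A k + B k ** G) ** sdp_\<Sigma> s k ** transpose (A k + B k ** G) +
      B k ** Q ** transpose (B k) + W k"
proof -
  have gain: "G ** sdp_\<Sigma> s k = sdp_P s k"
    "G ** sdp_\<Sigma> s k ** transpose G = sdp_P s k ** matrix_inv (sdp_\<Sigma> s k) ** transpose (sdp_P s k)"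
    using transpose_pd_gain[OF pd, of G "sdp_P s k"] by (simp_all only: G_def)
  show "psd Q"
    unfolding Q_def using s \<open>k < N\<close> by (intro schur_complement_psd[OF pd]) (auto simp: sdp_feasible_def)
  show M: "sdp_M s k = G ** sdp_\<Sigma> s k ** transpose G + Q"
    unfolding gain(2) Q_def by simp
  have step: "sdp_\<Sigma> s (Suc k) = A k ** sdp_\<Sigma> s k ** transpose (A k) +
      A k ** transpose (G ** sdp_\<Sigma> s k) ** transpose (B k) +
      B k ** (G ** sdp_\<Sigma> s k) ** transpose (A k) +
      B k ** (G ** sdp_\<Sigma> s k ** transpose G + Q) ** transpose (B k) + W k"
    using s \<open>k < N\<close> unfolding M[symmetric] unfolding gain(1) by (simp add: sdp_feasible_def)
  show "sdp_\<Sigma> s (Suc k) = (A k + B k ** G) ** sdp_\<Sigma> s k ** transpose (A k + B k ** G) +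
      B k ** Q ** transpose (B k) + W k"
    unfolding step using pd by (subst covariance_update) (simp_all add: pd_def)
qed

lemma nlp_of_sdp_feasible:
  assumes s: "sdp_feasible N A B W \<mu>0 \<Sigma>0 \<Sigma>d s" and pd: "\<And>k. k < N \<Longrightarrow> pd (sdp_\<Sigma> s k)"
  shows "nlp_feasible N A B W \<mu>0 \<Sigma>0 (nlp_of_sdp N s)"
  using s sdp_covariance_recursion(1,3)[OF s _ pd]
  unfolding nlp_feasible_def sdp_feasible_def nlp_of_sdp_def by simp

text \<open>
  The control costs agree; the inequality comes from the terminal term alone.
\<close>

lemma nlp_of_sdp_cost:
  assumes s: "sdp_feasible N A B W \<mu>0 \<Sigma>0 \<Sigma>d s" and pd: "\<And>k. k < N \<Longrightarrow> pd (sdp_\<Sigma> s k)"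
    and "lam \<ge> 0" and D: "pd \<Sigma>d"
  shows "nlp_cost N R lam \<mu>d \<Sigma>d (nlp_of_sdp N s) \<le> sdp_cost N R lam \<mu>d \<Sigma>d s"
proof -
  have "trace (sdp_L s) \<le> trace (mat_sqrt (mat_sqrt \<Sigma>d ** sdp_\<Sigma> s N ** mat_sqrt \<Sigma>d))"
    using s by (intro bures_trace_le[OF D]) (auto simp: sdp_feasible_def)
  then show ?thesis
    using \<open>lam \<ge> 0\<close> sdp_covariance_recursion(2)[OF s _ pd, symmetric]
    unfolding nlp_cost_def sdp_cost_def nlp_of_sdp_def
    by (simp add: trace_sub trace_scaleR mult_left_mono)
qed

lemma sdp_of_nlp_feasible:
  assumes z: "nlp_feasible N A B W \<mu>0 \<Sigma>0 z" and D: "pd \<Sigma>d"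
  shows "sdp_feasible N A B W \<mu>0 \<Sigma>0 \<Sigma>d (sdp_of_nlp N \<Sigma>d z)"
proof -
  have psd: "psd (nlp_\<Sigma> z k)" if "k \<le> N" for k
    using z that by (simp add: nlp_feasible_def)
  have step: "nlp_\<Sigma> z (Suc k) = A k ** nlp_\<Sigma> z k ** transpose (A k) +
      A k ** transpose (nlp_K z k ** nlp_\<Sigma> z k) ** transpose (B k) +
      B k ** (nlp_K z k ** nlp_\<Sigma> z k) ** transpose (A k) +
      B k ** (nlp_K z k ** nlp_\<Sigma> z k ** transpose (nlp_K z k) + nlp_Q z k) ** transpose (B k) + W k"
    if "k < N" for k
    using z that psd[of k] by (subst covariance_update) (auto simp: nlp_feasible_def psd_def)
  have block: "psd (nlp_K z k ** nlp_\<Sigma> z k ** transpose (nlp_K z k) + nlp_Q z k)"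
    "psd (block_mat (nlp_K z k ** nlp_\<Sigma> z k ** transpose (nlp_K z k) + nlp_Q z k)
      (nlp_K z k ** nlp_\<Sigma> z k) (transpose (nlp_K z k ** nlp_\<Sigma> z k)) (nlp_\<Sigma> z k))"
    if "k < N" for k
    using z that by (intro schur_block_psd psd; simp add: nlp_feasible_def)+
  show ?thesis
    using z step block psd[of N] bures_block_attained[OF D] mat_sqrt(1)[OF psd_sandwich[OF D]]
    unfolding nlp_feasible_def sdp_feasible_def sdp_of_nlp_def by simp
qed

text \<open>
  Equality, because \<open>L\<close> is chosen to be the square root occurring in the nonlinear cost.
\<close>

lemma sdp_of_nlp_cost:
  "sdp_cost N R lam \<mu>d \<Sigma>d (sdp_of_nlp N \<Sigma>d z) = nlp_cost N R lam \<mu>d \<Sigma>d z"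
proof -
  show ?thesis
    unfolding nlp_cost_def sdp_cost_def sdp_of_nlp_def by (simp add: trace_sub trace_scaleR)
qed

theorem theorem2:
  fixes N :: nat
    and lam :: real
    and \<mu>0 \<mu>d :: "real^'n"
    and \<Sigma>0 \<Sigma>d :: "real^'n^'n"
    and A :: "nat \<Rightarrow> real^'n^'n"
    and B :: "nat \<Rightarrow> real^'m^'n"
    and W :: "nat \<Rightarrow> real^'n^'n"
    and R :: "nat \<Rightarrow> real^'m^'m"
    and M :: "'w measure"
    and x0 :: "'w \<Rightarrow> real^'n"
    and w :: "nat \<Rightarrow> 'w \<Rightarrow> real^'n"
    and z' :: "('n, 'm) nlp_point"
    and z'' :: "('n, 'm) sdp_point"
  assumes "N > 0" and "lam > 0"
    and "pd \<Sigma>0" and "pd \<Sigma>d"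
    and "\<And>k. k < N \<Longrightarrow> psd (W k)"
    and "\<And>k. k < N \<Longrightarrow> pd (R k)"
    and "system_noise M N \<mu>0 \<Sigma>0 W x0 w"
    and "\<And>(v :: nat \<Rightarrow> real^'m) (K :: nat \<Rightarrow> nat \<Rightarrow> real^'n^'m) k.
           k \<le> N \<Longrightarrow> pd (covariance_mat M (state M A B x0 w v K k))"
    and "unique_arg_min (nlp_cost N R lam \<mu>d \<Sigma>d) (nlp_feasible N A B W \<mu>0 \<Sigma>0) z'"
    and "unique_arg_min (sdp_cost N R lam \<mu>d \<Sigma>d) (sdp_feasible N A B W \<mu>0 \<Sigma>0 \<Sigma>d) z''"
  shows "\<forall>k<N.
    nlp_v z' k = sdp_v z'' k \<and>
    nlp_\<mu> z' k = sdp_\<mu> z'' k \<and>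
    nlp_\<Sigma> z' k = sdp_\<Sigma> z'' k \<and>
    nlp_K z' k = sdp_P z'' k ** matrix_inv (sdp_\<Sigma> z'' k) \<and>
    nlp_Q z' k = sdp_M z'' k - sdp_P z'' k ** matrix_inv (sdp_\<Sigma> z'' k) ** transpose (sdp_P z'' k)"
proof -
  note nondegenerate = assms(8)
  have psd0: "psd \<Sigma>0" using assms(3) by (rule pd_imp_psd)
  have s: "sdp_feasible N A B W \<mu>0 \<Sigma>0 \<Sigma>d z''" and z: "nlp_feasible N A B W \<mu>0 \<Sigma>0 z'"
    using assms(9,10) by (auto simp: unique_arg_min_def is_arg_min_def)
  have pd: "pd (sdp_\<Sigma> z'' k)" if "k < N" for k
    using that
  proof (induction k)
    case 0
    then show ?case using s assms(3) by (simp add: sdp_feasible_def)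
  next
    case (Suc k)
    then have k: "k < N" and pdk: "pd (sdp_\<Sigma> z'' k)" by auto
    show ?case
      unfolding sdp_covariance_recursion(3)[OF s k pdk]
      by (rule covariance_step_pd[OF assms(7) psd0 assms(5) nondegenerate k pdk
            sdp_covariance_recursion(1)[OF s k pdk]])
  qed
  let ?z = "nlp_of_sdp N z''"
  have "nlp_cost N R lam \<mu>d \<Sigma>d ?z \<le> sdp_cost N R lam \<mu>d \<Sigma>d z''"
    using assms(2) by (intro nlp_of_sdp_cost[OF s pd _ assms(4)]) auto
  also have "\<dots> \<le> sdp_cost N R lam \<mu>d \<Sigma>d (sdp_of_nlp N \<Sigma>d z')"
    using assms(10) sdp_of_nlp_feasible[OF z assms(4)]
    by (auto simp: unique_arg_min_def is_arg_min_linorder)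
  also have "\<dots> = nlp_cost N R lam \<mu>d \<Sigma>d z'"
    by (rule sdp_of_nlp_cost)
  finally have le: "nlp_cost N R lam \<mu>d \<Sigma>d ?z \<le> nlp_cost N R lam \<mu>d \<Sigma>d z'" .
  have "is_arg_min (nlp_cost N R lam \<mu>d \<Sigma>d) (nlp_feasible N A B W \<mu>0 \<Sigma>0) ?z"
    unfolding is_arg_min_linorder
  proof (intro conjI allI impI)
    show "nlp_feasible N A B W \<mu>0 \<Sigma>0 ?z"
      by (rule nlp_of_sdp_feasible[OF s pd])
    fix y assume "nlp_feasible N A B W \<mu>0 \<Sigma>0 y"
    then have "nlp_cost N R lam \<mu>d \<Sigma>d z' \<le> nlp_cost N R lam \<mu>d \<Sigma>d y"
      using assms(9) unfolding unique_arg_min_def is_arg_min_linorder by blast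
    with le show "nlp_cost N R lam \<mu>d \<Sigma>d ?z \<le> nlp_cost N R lam \<mu>d \<Sigma>d y"
      by (rule order_trans)
  qed
  then have "z' = ?z"
    using assms(9) unfolding unique_arg_min_def by metis
  then show ?thesis
    by (simp add: nlp_of_sdp_def)
qed

end
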